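(* For every integer $d\geq 3$ there exist an infinite set $\mathcal{N}$ of positive integers and a function $\varepsilon:\mathcal{N}\to\mathbb{R}$ with $\varepsilon(N)\to 0$ as $N\to\infty$ in $\mathcal{N}$, such that for every $N\in\mathcal{N}$, \[ T(d,N) \geq \left((1-\varepsilon(N))\frac{N^{d-1}}{e^d}\right)^{N}, \] where $T(d,N)$ denotes the maximum number of transversals in an order-$N$ $d$-dimensional Latin hypercube.
   Context: An order-$N$ $d$-dimensional Latin hypercube is represented as a $0$-$1$ array $A:[N]^{d+1}\to\{0,1\}$ such that every line contains exactly one $1$; here a line is a set of tuples obtained by fixing all but one of the $d+1$ indices and letting the remaining index range over $[N]$. (Equivalently, an $[N]^d$ array over $[N]$ in which every symbol appears exactly once in each line.) A $1$-element of $A$ is a tuple $(i_1,\dots,i_{d+1})$ with $A(i_1,\dots,i_{d+1})=1$. A hyperplane of $A$ is a set of tuples obtained by fixing one of the $d+1$ indices and letting the other $d$ range over $[N]$. A transversal of $A$ is a set of $N$ $1$-elements of $A$ containing exactly one element from each hyperplane. *)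

theory Defs
  imports "HOL-Analysis.Analysis"
begin

text \<open>
  A \<open>d\<close>-dimensional order-\<open>N\<close> Latin hypercube is an array with \<open>d + 1\<close> indices.  An index tuple
  \<open>(i\<^sub>1, \<dots>, i\<^sub>d\<^sub>+\<^sub>1)\<close> with entries in \<open>[N] = {1..N}\<close> is an extensional function on \<open>{1..d + 1}\<close>,
  and an array is an extensional function on the set of these tuples, so that arrays agreeing
  on all cells are equal.
\<close>

definition cells :: "nat \<Rightarrow> nat \<Rightarrow> (nat \<Rightarrow> nat) set" where
  "cells d N = {1..d + 1} \<rightarrow>\<^sub>E {1..N}"

definition lines :: "nat \<Rightarrow> nat \<Rightarrow> (nat \<Rightarrow> nat) set set" where
  "lines d N = {{t(k := x) | x. x \<in> {1..N}} | k t. k \<in> {1..d + 1} \<and> t \<in> cells d N}"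

definition hyperplanes :: "nat \<Rightarrow> nat \<Rightarrow> (nat \<Rightarrow> nat) set set" where
  "hyperplanes d N = {{t \<in> cells d N. t k = x} | k x. k \<in> {1..d + 1} \<and> x \<in> {1..N}}"

definition latin_hypercubes :: "nat \<Rightarrow> nat \<Rightarrow> ((nat \<Rightarrow> nat) \<Rightarrow> nat) set" where
  "latin_hypercubes d N =
     {A \<in> cells d N \<rightarrow>\<^sub>E {0, 1}. \<forall>L \<in> lines d N. \<exists>!t. t \<in> L \<and> A t = 1}"

definition one_elements :: "nat \<Rightarrow> nat \<Rightarrow> ((nat \<Rightarrow> nat) \<Rightarrow> nat) \<Rightarrow> (nat \<Rightarrow> nat) set" where
  "one_elements d N A = {t \<in> cells d N. A t = 1}"

definition transversals ::
    "nat \<Rightarrow> nat \<Rightarrow> ((nat \<Rightarrow> nat) \<Rightarrow> nat) \<Rightarrow> (nat \<Rightarrow> nat) set set" where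
  "transversals d N A =
     {S. S \<subseteq> one_elements d N A \<and> card S = N \<and> (\<forall>H \<in> hyperplanes d N. \<exists>!t. t \<in> S \<and> t \<in> H)}"

definition max_transversals :: "nat \<Rightarrow> nat \<Rightarrow> nat" where
  "max_transversals d N = Max ((\<lambda>A. card (transversals d N A)) ` latin_hypercubes d N)"

text \<open>For \<open>N > 0\<close> the maximum is over a finite nonempty set.\<close>

lemma finite_cells: "finite (cells d N)"
  unfolding cells_def by (intro finite_PiE) auto

lemma finite_transversals: "finite (transversals d N A)"
proof (rule finite_subset)
  show "transversals d N A \<subseteq> Pow (cells d N)"
    by (auto simp: transversals_def one_elements_def)
qed (simp add: finite_cells)

lemma finite_latin_hypercubes: "finite (latin_hypercubes d N)"
proof (rule finite_subset)
  show "latin_hypercubes d N \<subseteq> cells d N \<rightarrow>\<^sub>E {0, 1}"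
    by (auto simp: latin_hypercubes_def)
  show "finite (cells d N \<rightarrow>\<^sub>E {0, 1::nat})"
    by (intro finite_PiE finite_cells) auto
qed

lemma ex1_residue:
  fixes c N :: nat
  assumes "N > 0"
  shows "\<exists>!x. x \<in> {1..N} \<and> N dvd c + x"
proof -
  have ex: "N - c mod N \<in> {1..N} \<and> N dvd c + (N - c mod N)"
  proof -
    have "c mod N < N" using assms by simp
    moreover have "c + (N - c mod N) = N * (c div N) + N"
      using \<open>c mod N < N\<close> mult_div_mod_eq[of N c] by linarith
    ultimately show ?thesis by auto
  qed
  have le: "x = y" if "x \<in> {1..N}" "y \<in> {1..N}" "N dvd c + x" "N dvd c + y" "x \<le> y" for x y
  proof (rule ccontr)
    assume "x \<noteq> y"
    have "N dvd (c + y) - (c + x)" using that by (intro dvd_diff_nat)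
    then have "N dvd y - x" by simp
    moreover have "0 < y - x" "y - x < N" using that \<open>x \<noteq> y\<close> by auto
    ultimately show False using nat_dvd_not_less by blast
  qed
  have "x = y" if "x \<in> {1..N}" "y \<in> {1..N}" "N dvd c + x" "N dvd c + y" for x y
    using that le[of x y] le[of y x] by (cases "x \<le> y") simp_all
  with ex show ?thesis by blast
qed

lemma latin_hypercubes_nonempty:
  assumes "N > 0"
  shows "latin_hypercubes d N \<noteq> {}"
proof -
  define A where "A = (\<lambda>t \<in> cells d N. if N dvd (\<Sum>j \<in> {1..d + 1}. t j) then 1 else (0::nat))"
  have "\<exists>!s. s \<in> L \<and> A s = 1" if "L \<in> lines d N" for L
  proof -
    obtain k t where k: "k \<in> {1..d + 1}" and t: "t \<in> cells d N"
      and L: "L = {t(k := x) | x. x \<in> {1..N}}"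
      using \<open>L \<in> lines d N\<close> by (auto simp: lines_def)
    define c where "c = (\<Sum>j \<in> {1..d + 1} - {k}. t j)"
    have upd: "t(k := x) \<in> cells d N" if "x \<in> {1..N}" for x
      using t k that unfolding cells_def by (auto simp: PiE_iff extensional_def)
    have sum: "(\<Sum>j \<in> {1..d + 1}. (t(k := x)) j) = c + x" for x
    proof -
      have "(\<Sum>j \<in> {1..d + 1} - {k}. (t(k := x)) j) = c"
        unfolding c_def by (intro sum.cong) auto
      then show ?thesis
        using sum.remove[of "{1..d + 1}" k "t(k := x)"] k by simp
    qed
    have A: "A (t(k := x)) = 1 \<longleftrightarrow> N dvd c + x" if "x \<in> {1..N}" for x
      using upd[OF that] sum[of x] by (simp add: A_def)
    obtain x where x: "x \<in> {1..N}" "N dvd c + x"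
      and uniq: "\<And>y. y \<in> {1..N} \<Longrightarrow> N dvd c + y \<Longrightarrow> y = x"
      using ex1_residue[OF assms, of c] by blast
    show ?thesis
    proof (rule ex1I[of _ "t(k := x)"])
      show "t(k := x) \<in> L \<and> A (t(k := x)) = 1"
        using x A L by blast
      fix s assume "s \<in> L \<and> A s = 1"
      then show "s = t(k := x)"
        using L A uniq by blast
    qed
  qed
  moreover have "A \<in> cells d N \<rightarrow>\<^sub>E {0, 1}"
    by (auto simp: A_def)
  ultimately have "A \<in> latin_hypercubes d N"
    by (simp add: latin_hypercubes_def)
  then show ?thesis by blast
qed

end

theory Submission
  imports Defs "HOL-Combinatorics.Permutations" "HOL-Real_Asymp.Real_Asymp"
begin

text \<open>
  Take \<open>N = n\<^sup>d\<^sup>+\<^sup>1\<close>, identify \<open>[N]\<close> with \<open>\<int>\<^sub>n \<times> [s]\<close> for \<open>s = n\<^sup>d\<close>, and build a Latin hypercube from the block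
  pattern \<open>a\<^sub>1 + \<dots> + a\<^sub>d\<^sub>+\<^sub>1 = 0\<close> in \<open>\<int>\<^sub>n\<close>, filling each of the \<open>n\<^sup>d\<close> blocks with an independent random isotope
  of the cyclic hypercube of order \<open>s\<close>. Consider the diagonals (sets of cells meeting each hyperplane
  once) that have exactly \<open>k = n\<close> cells in every block. A block then receives \<open>k\<close> cells out of order
  \<open>s\<close> with \<open>k / s \<rightarrow> 0\<close>, so the random isotope contains all of them with probability at least
  \<open>((s - 2 k) / s\<^sup>2)\<^sup>k\<close>, by a greedy choice. There are \<open>(s!) ^ (n (d + 1)) / (k!) ^ (n ^ d)\<close> such
  diagonals, so the expected number of transversals, and hence the maximum, is at least
  \<open>(s!) ^ (n (d + 1)) / (k!) ^ (n ^ d) \<cdot> ((s - 2 k) / s\<^sup>2)\<^sup>N\<close>. Because both \<open>k\<close> and \<open>s / k\<close> tend to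
  infinity, Stirling's formula turns this into the claimed bound.
\<close>

section \<open>Solving linear congruences with representatives below the modulus\<close>

lemma dvd_add_less_unique:
  fixes a b c s :: nat
  assumes "s dvd a + c" "s dvd b + c" "a < s" "b < s"
  shows "a = b"
proof -
  have *: "x = y" if "s dvd x + c" "s dvd y + c" "y < s" "x \<le> y" for x y
  proof -
    have "s dvd (y + c) - (x + c)" using that by (intro dvd_diff_nat)
    then have "s dvd y - x" by simp
    then show ?thesis using that by (cases "x = y") (auto dest!: dvd_imp_le)
  qed
  show ?thesis using *[of a b] *[of b a] assms by (cases "a \<le> b") auto
qed

lemma ex_less_dvd_add:
  fixes c s :: nat
  assumes "s > 0"
  shows "\<exists>y<s. s dvd y + c"
proof -
  obtain x where "x \<in> {1..s}" "s dvd c + x"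
    using ex1_residue[OF assms, of c] by blast
  \<comment> \<open>\<open>ex1_residue\<close> yields a representative in \<open>{1..s}\<close>; the
    value \<open>s\<close> has to become \<open>0\<close> to lie below \<open>s\<close>.\<close>
  then show ?thesis
    by (intro exI[of _ "if x = s then 0 else x"]) (auto simp: add.commute)
qed

section \<open>Pairs of permutations satisfying prescribed congruences\<close>

lemma transpose_comp_cancel:
  "Transposition.transpose a b \<circ> (Transposition.transpose a b \<circ> f) = f"
  by (simp add: comp_assoc[symmetric])

definition perm_pairs ::
    "nat \<Rightarrow> ('a \<Rightarrow> nat) \<Rightarrow> ('a \<Rightarrow> nat) \<Rightarrow> ('a \<Rightarrow> nat) \<Rightarrow> 'a set \<Rightarrow> ((nat \<Rightarrow> nat) \<times> (nat \<Rightarrow> nat)) set" where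
  "perm_pairs s p q w X =
     {(\<sigma>, \<rho>). \<sigma> permutes {..<s} \<and> \<rho> permutes {..<s} \<and> (\<forall>x\<in>X. s dvd \<sigma> (p x) + \<rho> (q x) + w x)}"

lemma finite_perm_pairs: "finite (perm_pairs s p q w X)"
proof (rule finite_subset)
  show "perm_pairs s p q w X \<subseteq> {\<sigma>. \<sigma> permutes {..<s}} \<times> {\<rho>. \<rho> permutes {..<s}}"
    by (auto simp: perm_pairs_def)
qed (simp add: finite_permutations)

text \<open>
  Switching: composing a good pair with two transpositions moves the images of \<open>p x\<close> and \<open>q x\<close> to
  \<open>c\<close> and \<open>- c - w x\<close>. At least \<open>s - 2 |X|\<close> values \<open>c\<close> leave the constraints on \<open>X\<close> intact, and the old
  images of \<open>p x\<close> and \<open>q x\<close> suffice to undo the move.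
\<close>

lemma perm_pairs_insert:
  assumes "s > 0" "finite X" "x \<notin> X" "inj_on p (insert x X)" "inj_on q (insert x X)"
    and "p ` insert x X \<subseteq> {..<s}" "q ` insert x X \<subseteq> {..<s}"
  shows "(s - 2 * card X) * card (perm_pairs s p q w X) \<le> s\<^sup>2 * card (perm_pairs s p q w (insert x X))"
proof -
  let ?t = "Transposition.transpose :: nat \<Rightarrow> _"
  have "\<exists>neg. \<forall>c. neg c < s \<and> s dvd neg c + (c + w x)"
    by (intro choice allI ex_less_dvd_add[OF \<open>s > 0\<close>])
  then obtain neg where neg: "\<And>c. neg c < s" "\<And>c. s dvd neg c + (c + w x)"
    by blast
  \<comment> \<open>Distinct \<open>c\<close> have distinct \<open>neg c\<close>, so the condition
    on \<open>neg c\<close> in \<open>D\<close> excludes at most \<open>card X\<close> values of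
    \<open>c\<close>.\<close>
  have inj_neg: "inj_on neg {..<s}"
  proof (rule inj_onI)
    fix a b assume ab: "a \<in> {..<s}" "b \<in> {..<s}" "neg a = neg b"
    show "a = b"
      by (rule dvd_add_less_unique[of s _ "neg a + w x"])
        (use neg(2)[of a] neg(2)[of b] ab in \<open>auto simp: add_ac\<close>)
  qed
  define D where "D = (\<lambda>(\<sigma>, \<rho>). {c \<in> {..<s}. c \<notin> \<sigma> ` p ` X \<and> neg c \<notin> \<rho> ` q ` X})"
  have D: "s - 2 * card X \<le> card (D z)" for z :: "(nat \<Rightarrow> nat) \<times> (nat \<Rightarrow> nat)"
  proof -
    obtain \<sigma> \<rho> where z: "z = (\<sigma>, \<rho>)" by fastforce
    let ?Y = "\<sigma> ` p ` X" and ?Z = "neg -` (\<rho> ` q ` X) \<inter> {..<s}"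
    have "card ?Y \<le> card X"
      using card_image_le[of X "\<lambda>x. \<sigma> (p x)"] assms by (simp add: image_image)
    moreover have "card ?Z \<le> card (\<rho> ` q ` X)"
      by (rule card_vimage_inj_on_le) (use inj_neg assms in auto)
    moreover have "card (\<rho> ` q ` X) \<le> card X"
      using card_image_le[of X "\<lambda>x. \<rho> (q x)"] assms by (simp add: image_image)
    moreover have "card {..<s} - card (?Y \<union> ?Z) \<le> card ({..<s} - (?Y \<union> ?Z))"
      by (intro diff_card_le_card_Diff) (use assms in auto)
    moreover have "card (?Y \<union> ?Z) \<le> card ?Y + card ?Z" by (rule card_Un_le)
    moreover have "D z = {..<s} - (?Y \<union> ?Z)" by (auto simp: D_def z)
    ultimately show ?thesis by simp
  qed
  define F where "F = (\<lambda>((\<sigma> :: nat \<Rightarrow> nat, \<rho> :: nat \<Rightarrow> nat), c).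
    ((?t (\<sigma> (p x)) c \<circ> \<sigma>, ?t (\<rho> (q x)) (neg c) \<circ> \<rho>), (\<sigma> (p x), \<rho> (q x))))"
  have "inj_on F (Sigma (perm_pairs s p q w X) D)"
  proof (rule inj_onI, clarsimp)
    fix \<sigma> \<rho> c \<sigma>' \<rho>' c'
    assume "F ((\<sigma>, \<rho>), c) = F ((\<sigma>', \<rho>'), c')"
    then have eq: "?t (\<sigma> (p x)) c \<circ> \<sigma> = ?t (\<sigma> (p x)) c' \<circ> \<sigma>'"
      "?t (\<rho> (q x)) (neg c) \<circ> \<rho> = ?t (\<rho> (q x)) (neg c') \<circ> \<rho>'"
      "\<sigma> (p x) = \<sigma>' (p x)" "\<rho> (q x) = \<rho>' (q x)"
      by (auto simp: F_def)
    \<comment> \<open>The switched first permutation maps \<open>p x\<close> to \<open>c\<close>, so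
      \<open>c\<close> can be read off; both transpositions are then known and, being involutions,
      cancel.\<close>
    from fun_cong[OF eq(1), of "p x"] have "c = c'" using eq(3) by simp
    then show "\<sigma> = \<sigma>' \<and> \<rho> = \<rho>' \<and> c = c'"
      using eq by (metis transpose_comp_cancel)
  qed
  moreover have "F ` Sigma (perm_pairs s p q w X) D \<subseteq> perm_pairs s p q w (insert x X) \<times> ({..<s} \<times> {..<s})"
  proof (rule image_subsetI)
    fix y assume "y \<in> Sigma (perm_pairs s p q w X) D"
    then obtain \<sigma> \<rho> c where y: "y = ((\<sigma>, \<rho>), c)" and \<sigma>: "\<sigma> permutes {..<s}" and \<rho>: "\<rho> permutes {..<s}"
      and X: "\<And>x. x \<in> X \<Longrightarrow> s dvd \<sigma> (p x) + \<rho> (q x) + w x"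
      and c: "c < s" "c \<notin> \<sigma> ` p ` X" "neg c \<notin> \<rho> ` q ` X"
      by (auto simp: perm_pairs_def D_def)
    have in_s: "\<sigma> (p x) \<in> {..<s}" "\<rho> (q x) \<in> {..<s}"
      using assms(6,7) permutes_in_image[OF \<sigma>] permutes_in_image[OF \<rho>] by blast+
    have "?t (\<sigma> (p x)) c \<circ> \<sigma> permutes {..<s}"
      using c in_s \<sigma> by (intro permutes_compose permutes_swap_id) auto
    moreover have "?t (\<rho> (q x)) (neg c) \<circ> \<rho> permutes {..<s}"
      using neg(1) in_s \<rho> by (intro permutes_compose permutes_swap_id) auto
    moreover have "(?t (\<sigma> (p x)) c \<circ> \<sigma>) (p z) = \<sigma> (p z)" "(?t (\<rho> (q x)) (neg c) \<circ> \<rho>) (q z) = \<rho> (q z)"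
      if "z \<in> X" for z
    proof -
      have "p z \<noteq> p x" "q z \<noteq> q x"
        using that assms(3-5) by (auto simp: inj_on_def)
      then have "\<sigma> (p z) \<noteq> \<sigma> (p x)" "\<rho> (q z) \<noteq> \<rho> (q x)"
        using permutes_inj[OF \<sigma>] permutes_inj[OF \<rho>] by (auto dest: injD)
      then show "(?t (\<sigma> (p x)) c \<circ> \<sigma>) (p z) = \<sigma> (p z)" "(?t (\<rho> (q x)) (neg c) \<circ> \<rho>) (q z) = \<rho> (q z)"
        using c imageI[OF imageI[OF that, of p], of \<sigma>] imageI[OF imageI[OF that, of q], of \<rho>]
        by (metis comp_apply transpose_apply_other)+
    qed
    moreover have "s dvd c + neg c + w x" using neg(2)[of c] by (simp add: add_ac)
    ultimately show "F y \<in> perm_pairs s p q w (insert x X) \<times> ({..<s} \<times> {..<s})"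
      using X in_s by (auto simp: y F_def perm_pairs_def)
  qed
  ultimately have "card (Sigma (perm_pairs s p q w X) D)
      \<le> card (perm_pairs s p q w (insert x X) \<times> ({..<s} \<times> {..<s}))"
    by (rule card_inj_on_le) (simp add: finite_perm_pairs)
  also have "\<dots> = s\<^sup>2 * card (perm_pairs s p q w (insert x X))"
    by (simp add: card_cartesian_product power2_eq_square)
  finally have "card (Sigma (perm_pairs s p q w X) D) \<le> s\<^sup>2 * card (perm_pairs s p q w (insert x X))" .
  moreover have "card (Sigma (perm_pairs s p q w X) D) = (\<Sum>z\<in>perm_pairs s p q w X. card (D z))"
    by (intro card_SigmaI) (auto simp: finite_perm_pairs D_def)
  moreover have "\<dots> \<ge> (\<Sum>z\<in>perm_pairs s p q w X. s - 2 * card X)"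
    by (intro sum_mono D)
  ultimately show ?thesis by (simp add: mult.commute)
qed

text \<open>Start from all (s!)^2 pairs and impose the constraints one at a time. Fewer than
  \<open>k\<close> points precede each new one, so \<open>perm_pairs_insert\<close> keeps at least a
  fraction (s - 2k)/s^2 of the pairs. Multiplying out denominators keeps the bound in the
  naturals.\<close>

lemma card_perm_pairs_ge:
  assumes "s > 0" "finite X" "card X \<le> k" "inj_on p X" "inj_on q X" "p ` X \<subseteq> {..<s}" "q ` X \<subseteq> {..<s}"
  shows "(fact s)\<^sup>2 * (s - 2 * k) ^ card X \<le> card (perm_pairs s p q w X) * s ^ (2 * card X)"
  using assms(2-)
proof (induction X rule: finite_induct)
  case empty
  have "perm_pairs s p q w {} = {\<sigma>. \<sigma> permutes {..<s}} \<times> {\<rho>. \<rho> permutes {..<s}}"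
    by (auto simp: perm_pairs_def)
  then show ?case
    by (simp add: card_cartesian_product card_permutations[OF card_lessThan] power2_eq_square)
next
  case (insert x X)
  have "(fact s)\<^sup>2 * (s - 2 * k) ^ card (insert x X) = (fact s)\<^sup>2 * (s - 2 * k) ^ card X * (s - 2 * k)"
    using insert by simp
  also have "\<dots> \<le> card (perm_pairs s p q w X) * s ^ (2 * card X) * (s - 2 * card X)"
    using insert by (intro mult_mono insert.IH) auto
  also have "\<dots> = ((s - 2 * card X) * card (perm_pairs s p q w X)) * s ^ (2 * card X)"
    by simp
  also have "\<dots> \<le> (s\<^sup>2 * card (perm_pairs s p q w (insert x X))) * s ^ (2 * card X)"
    using insert assms(1) by (intro mult_right_mono perm_pairs_insert) auto
  also have "\<dots> = card (perm_pairs s p q w (insert x X)) * s ^ (2 * card (insert x X))"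
    using insert by (simp add: power2_eq_square power_add algebra_simps)
  finally show ?case .
qed

section \<open>Counting tuples of residues with prescribed sum\<close>

text \<open>Single out one index: the other entries are free, and the congruence then determines the
  entry at that index uniquely.\<close>

lemma card_PiE_dvd_sum:
  fixes n c :: nat
  assumes "n > 0" "finite I" "I \<noteq> {}"
  shows "card {a \<in> I \<rightarrow>\<^sub>E {..<n}. n dvd (\<Sum>i\<in>I. a i) + c} = n ^ (card I - 1)"
proof -
  obtain i where "i \<in> I" using assms by blast
  define J where "J = I - {i}"
  have I: "I = insert i J" "i \<notin> J" "finite J"
    using \<open>i \<in> I\<close> assms by (auto simp: J_def)
  have sum: "(\<Sum>j\<in>I. a j) + c = a i + ((\<Sum>j\<in>J. a j) + c)" for a :: "'a \<Rightarrow> nat"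
    unfolding I(1) using I(2,3) by simp
  have "bij_betw (\<lambda>a. restrict a J) {a \<in> I \<rightarrow>\<^sub>E {..<n}. n dvd (\<Sum>i\<in>I. a i) + c} (J \<rightarrow>\<^sub>E {..<n})"
  proof (rule bij_betw_imageI)
    show "inj_on (\<lambda>a. restrict a J) {a \<in> I \<rightarrow>\<^sub>E {..<n}. n dvd (\<Sum>i\<in>I. a i) + c}"
    proof (rule inj_onI, clarify)
      fix a b
      assume a: "a \<in> I \<rightarrow>\<^sub>E {..<n}" "n dvd (\<Sum>i\<in>I. a i) + c"
        and b: "b \<in> I \<rightarrow>\<^sub>E {..<n}" "n dvd (\<Sum>i\<in>I. b i) + c"
        and eq: "restrict a J = restrict b J"
      have J: "a j = b j" if "j \<in> J" for j
        using fun_cong[OF eq, of j] that by simp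
      then have "(\<Sum>j\<in>J. a j) = (\<Sum>j\<in>J. b j)" by simp
      then have "a i = b i"
        using a b \<open>i \<in> I\<close> by (intro dvd_add_less_unique[of n "a i" "(\<Sum>j\<in>J. a j) + c"])
          (auto simp: sum)
      then show "a = b"
        using J a b I by (intro PiE_ext[of a I _ b]) auto
    qed
    show "(\<lambda>a. restrict a J) ` {a \<in> I \<rightarrow>\<^sub>E {..<n}. n dvd (\<Sum>i\<in>I. a i) + c} = J \<rightarrow>\<^sub>E {..<n}"
    proof (intro equalityI subsetI)
      fix b assume b: "b \<in> J \<rightarrow>\<^sub>E {..<n}"
      obtain y where y: "y < n" "n dvd y + ((\<Sum>j\<in>J. b j) + c)"
        using ex_less_dvd_add[OF assms(1)] by blast
      have "(\<Sum>j\<in>J. (b(i := y)) j) = (\<Sum>j\<in>J. b j)"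
        using I by (intro sum.cong) auto
      then have "b(i := y) \<in> {a \<in> I \<rightarrow>\<^sub>E {..<n}. n dvd (\<Sum>i\<in>I. a i) + c}"
        using b y I(2) by (auto simp: sum) (auto simp: I(1) PiE_iff extensional_def)
      moreover have "restrict (b(i := y)) J = b"
        using b I by (auto simp: fun_eq_iff PiE_iff extensional_def)
      ultimately show "b \<in> (\<lambda>a. restrict a J) ` {a \<in> I \<rightarrow>\<^sub>E {..<n}. n dvd (\<Sum>i\<in>I. a i) + c}"
        by (intro image_eqI[where x = "b(i := y)"]) simp_all
    qed (use I in auto)
  qed
  then have "card {a \<in> I \<rightarrow>\<^sub>E {..<n}. n dvd (\<Sum>i\<in>I. a i) + c} = card (J \<rightarrow>\<^sub>E {..<n})"
    by (rule bij_betw_same_card)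
  then show ?thesis using I by (simp add: card_funcsetE)
qed

text \<open>Once entry \<open>i\<close> is fixed, \<open>v\<close> plays the role of the constant
  \<open>c\<close> in \<open>card_PiE_dvd_sum\<close> on the remaining indices, which are nonempty
  because \<open>card I\<close> is at least 2.\<close>

lemma card_PiE_dvd_sum_fibre:
  fixes n v :: nat
  assumes "n > 0" "finite I" "i \<in> I" "card I \<ge> 2" "v < n"
  shows "card {a \<in> I \<rightarrow>\<^sub>E {..<n}. n dvd (\<Sum>j\<in>I. a j) \<and> a i = v} = n ^ (card I - 2)"
proof -
  define J where "J = I - {i}"
  have J: "i \<notin> J" "finite J" and cJ: "card J = card I - 1"
    using assms by (auto simp: J_def)
  have "J \<noteq> {}"
  proof
    assume "J = {}"
    then show False using cJ assms(4) by simp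
  qed
  have sum: "(\<Sum>j\<in>I. a j) = (\<Sum>j\<in>J. a j) + a i" for a :: "'a \<Rightarrow> nat"
    unfolding J_def using sum.remove[OF assms(2,3), of a] by simp
  have "bij_betw (\<lambda>a. a(i := v)) {a \<in> J \<rightarrow>\<^sub>E {..<n}. n dvd (\<Sum>j\<in>J. a j) + v}
      {a \<in> I \<rightarrow>\<^sub>E {..<n}. n dvd (\<Sum>j\<in>I. a j) \<and> a i = v}"
  proof (rule bij_betw_byWitness[where f' = "\<lambda>a. restrict a J"])
    show "\<forall>a\<in>{a \<in> J \<rightarrow>\<^sub>E {..<n}. n dvd (\<Sum>j\<in>J. a j) + v}. restrict (a(i := v)) J = a"
      using J by (auto simp: fun_eq_iff PiE_iff extensional_def)
    show "\<forall>a\<in>{a \<in> I \<rightarrow>\<^sub>E {..<n}. n dvd (\<Sum>j\<in>I. a j) \<and> a i = v}. (restrict a J)(i := v) = a"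
      by (auto simp: fun_eq_iff PiE_iff extensional_def J_def)
    show "(\<lambda>a. a(i := v)) ` {a \<in> J \<rightarrow>\<^sub>E {..<n}. n dvd (\<Sum>j\<in>J. a j) + v}
        \<subseteq> {a \<in> I \<rightarrow>\<^sub>E {..<n}. n dvd (\<Sum>j\<in>I. a j) \<and> a i = v}"
    proof (rule image_subsetI)
      fix a assume a: "a \<in> {a \<in> J \<rightarrow>\<^sub>E {..<n}. n dvd (\<Sum>j\<in>J. a j) + v}"
      have "(\<Sum>j\<in>J. (a(i := v)) j) = (\<Sum>j\<in>J. a j)"
        using J by (intro sum.cong) auto
      then have "n dvd (\<Sum>j\<in>I. (a(i := v)) j)"
        using a unfolding sum by simp
      moreover have "a(i := v) \<in> I \<rightarrow>\<^sub>E {..<n}"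
        using a assms by (auto simp: PiE_iff extensional_def J_def)
      ultimately show "a(i := v) \<in> {a \<in> I \<rightarrow>\<^sub>E {..<n}. n dvd (\<Sum>j\<in>I. a j) \<and> a i = v}"
        by simp
    qed
    show "(\<lambda>a. restrict a J) ` {a \<in> I \<rightarrow>\<^sub>E {..<n}. n dvd (\<Sum>j\<in>I. a j) \<and> a i = v}
        \<subseteq> {a \<in> J \<rightarrow>\<^sub>E {..<n}. n dvd (\<Sum>j\<in>J. a j) + v}"
      by (auto simp: sum) (auto simp: J_def)
  qed
  then have "card {a \<in> I \<rightarrow>\<^sub>E {..<n}. n dvd (\<Sum>j\<in>I. a j) \<and> a i = v}
      = card {a \<in> J \<rightarrow>\<^sub>E {..<n}. n dvd (\<Sum>j\<in>J. a j) + v}"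
    by (rule bij_betw_same_card[symmetric])
  then show ?thesis
    using card_PiE_dvd_sum[OF assms(1) \<open>finite J\<close> \<open>J \<noteq> {}\<close>, of v] cJ by (simp add: numeral_2_eq_2)
qed

section \<open>Elementary Stirling bounds\<close>

text \<open>Induction, with (1 + 1/n)^n <= e controlling the growth of the left side.\<close>

lemma fact_ge_power_div_exp: "(real n / exp 1) ^ n \<le> fact n"
proof (induction n)
  case (Suc n)
  have *: "real (Suc n) ^ n \<le> exp 1 * real n ^ n"
  proof (cases "n = 0")
    case False
    have "(real (Suc n) / real n) ^ n \<le> exp 1"
      using exp_ge_one_plus_x_over_n_power_n[of n 1] False by (simp add: field_simps)
    then show ?thesis using False by (simp add: power_divide pos_divide_le_eq)
  qed simp
  have "(real (Suc n) / exp 1) ^ Suc n = (real (Suc n) / exp 1) * (real (Suc n) ^ n / exp 1 ^ n)"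
    by (simp add: power_divide)
  also have "\<dots> \<le> (real (Suc n) / exp 1) * ((exp 1 * real n ^ n) / exp 1 ^ n)"
    using * by (intro mult_left_mono divide_right_mono) auto
  also have "\<dots> = real (Suc n) * (real n / exp 1) ^ n"
    by (simp add: power_divide)
  also have "\<dots> \<le> real (Suc n) * fact n"
    using Suc by (intro mult_left_mono) auto
  finally show ?case by simp
qed simp

text \<open>Induction from equality at n = 1, now with (1 + 1/n)^(n+1) >= e. That inequality comes
  from exp(-1/(n+1)) >= n/(n+1).\<close>

lemma fact_le_power_div_exp:
  assumes "n > 0"
  shows "fact n \<le> exp 1 * real n * (real n / exp 1) ^ n"
  using assms
proof (induction n rule: nat_induct_non_zero)
  case (Suc n)
  have "exp (1 / real (Suc n)) \<le> 1 / (1 - 1 / real (Suc n))"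
    using exp_ge_add_one_self[of "- 1 / real (Suc n)"] Suc
    by (simp add: exp_minus field_simps)
  also have "\<dots> = real (Suc n) / real n"
    using Suc by (simp add: field_simps)
  finally have "exp (1 / real (Suc n)) ^ Suc n \<le> (real (Suc n) / real n) ^ Suc n"
    by (intro power_mono) auto
  then have "exp 1 \<le> (real (Suc n) / real n) ^ Suc n"
    by (simp add: exp_of_nat_mult[symmetric] del: power_Suc of_nat_Suc)
  then have *: "exp 1 * real n * real n ^ n \<le> real (Suc n) ^ Suc n"
    using Suc by (simp add: power_divide field_simps)
  have "fact (Suc n) = real (Suc n) * fact n" by simp
  also have "\<dots> \<le> real (Suc n) * (exp 1 * real n * (real n / exp 1) ^ n)"
    using Suc by (intro mult_left_mono) auto
  also have "\<dots> = real (Suc n) * (exp 1 * real n * real n ^ n) / exp 1 ^ n"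
    by (simp add: power_divide)
  also have "\<dots> \<le> real (Suc n) * real (Suc n) ^ Suc n / exp 1 ^ n"
    using * by (intro divide_right_mono mult_left_mono) auto
  also have "\<dots> = exp 1 * real (Suc n) * (real (Suc n) / exp 1) ^ Suc n"
    by (simp add: power_divide)
  finally show ?case .
qed simp

section \<open>Double counting and counting of bijections\<close>

lemma sum_card_swap:
  assumes "finite A" "finite B"
  shows "(\<Sum>a\<in>A. card {b \<in> B. R a b}) = (\<Sum>b\<in>B. card {a \<in> A. R a b})"
proof -
  have "(\<Sum>a\<in>A. card {b \<in> B. R a b}) = (\<Sum>a\<in>A. \<Sum>b\<in>B. if R a b then 1 else 0)"
    using assms by (simp add: sum.If_cases Int_def)
  also have "\<dots> = (\<Sum>b\<in>B. \<Sum>a\<in>A. if R a b then 1 else 0)"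
    by (rule sum.swap)
  also have "\<dots> = (\<Sum>b\<in>B. card {a \<in> A. R a b})"
    using assms by (simp add: sum.If_cases Int_def)
  finally show ?thesis .
qed

lemma card_inj_funcset:
  assumes "finite A" "finite C" "card A = k" "card C = k"
  shows "card {f \<in> A \<rightarrow>\<^sub>E C. inj_on f A} = fact k"
  using card_inj_on_subset_funcset[OF assms(1,2) subset_refl] assms(3,4)
  by (simp add: fact_prod_rev)

section \<open>The block construction of Latin hypercubes\<close>

text \<open>
  The coordinate value \<open>x\<close> stands for \<open>e x = (a, b)\<close>, where \<open>a\<close> selects a residue in \<open>\<int>\<^sub>n\<close> and \<open>b\<close> a
  position in \<open>[s]\<close>; \<open>P a i\<close> is the permutation of \<open>[s]\<close> applied to the \<open>i\<close>-th coordinate in block \<open>a\<close>.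
\<close>

locale block_cube =
  fixes d n k :: nat and s N :: nat and e :: "nat \<Rightarrow> nat \<times> nat"
  assumes d: "d \<ge> 1" and n: "n > 0" and k: "k > 0"
    and s: "s = n ^ (d - 1) * k" and N: "N = n * s"
    and e: "bij_betw e {1..N} ({..<n} \<times> {..<s})"
begin

definition I where "I = {1..d + 1}"

definition blocks :: "(nat \<Rightarrow> nat) set" where
  "blocks = {a \<in> I \<rightarrow>\<^sub>E {..<n}. n dvd (\<Sum>i\<in>I. a i)}"

definition block :: "(nat \<Rightarrow> nat) \<Rightarrow> nat \<Rightarrow> nat" where
  "block t = (\<lambda>i\<in>I. fst (e (t i)))"

definition cube :: "((nat \<Rightarrow> nat) \<Rightarrow> nat \<Rightarrow> nat \<Rightarrow> nat) \<Rightarrow> (nat \<Rightarrow> nat) \<Rightarrow> nat" where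
  "cube P = (\<lambda>t\<in>cells d N.
     if block t \<in> blocks \<and> s dvd (\<Sum>i\<in>I. P (block t) i (snd (e (t i)))) then 1 else 0)"

lemma s_pos: "s > 0" using s n k by simp

lemma finite_I [simp]: "finite I" and card_I: "card I = d + 1"
  by (simp_all add: I_def)

lemma finite_blocks [simp]: "finite blocks"
  unfolding blocks_def by (rule finite_subset[of _ "I \<rightarrow>\<^sub>E {..<n}"]) (auto intro: finite_PiE)

lemma card_blocks: "card blocks = n ^ d"
  using card_PiE_dvd_sum[of n I 0] n by (simp add: blocks_def card_I I_def)

lemma card_blocks_k: "card blocks * k = N"
proof -
  have "n ^ d = n * n ^ (d - 1)" using d by (cases d) auto
  then show ?thesis by (simp add: card_blocks N s)
qed

lemma e_in: "x \<in> {1..N} \<Longrightarrow> fst (e x) < n \<and> snd (e x) < s"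
  using bij_betwE[OF e] by (auto simp: mem_Times_iff)

lemma ex_e: "u < n \<Longrightarrow> v < s \<Longrightarrow> \<exists>x\<in>{1..N}. e x = (u, v)"
  using bij_betw_imp_surj_on[OF e] by (metis SigmaI imageE lessThan_iff)

lemma e_inj: "x \<in> {1..N} \<Longrightarrow> y \<in> {1..N} \<Longrightarrow> e x = e y \<Longrightarrow> x = y"
  using bij_betw_imp_inj_on[OF e] by (auto dest: inj_onD)

text \<open>Along a line in direction \<open>i\<close>, the congruence modulo \<open>n\<close> first
  forces the residue of the moving coordinate. Inside the resulting block, the congruence modulo
  \<open>s\<close> forces the image of its position under \<open>P a i\<close>, hence the position
  itself.\<close>

lemma cube_latin:
  assumes P: "\<And>a i. a \<in> blocks \<Longrightarrow> i \<in> I \<Longrightarrow> P a i permutes {..<s}"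
  shows "cube P \<in> latin_hypercubes d N"
proof -
  have "\<exists>!t. t \<in> L \<and> cube P t = 1" if "L \<in> lines d N" for L
  proof -
    obtain i t where i: "i \<in> I" and t: "t \<in> cells d N" and L: "L = {t(i := x) | x. x \<in> {1..N}}"
      using \<open>L \<in> lines d N\<close> by (auto simp: lines_def I_def)
    have upd: "t(i := x) \<in> cells d N" if "x \<in> {1..N}" for x
      using t i that unfolding cells_def by (auto simp: PiE_iff extensional_def I_def)
    have t_in: "t j \<in> {1..N}" if "j \<in> I" for j
      using t that by (auto simp: cells_def I_def PiE_iff)
    have split: "(\<Sum>j\<in>I. f j) = f i + (\<Sum>j\<in>I - {i}. f j)" for f :: "nat \<Rightarrow> nat"
      by (rule sum.remove) (use i in auto)
    define c where "c = (\<Sum>j\<in>I - {i}. fst (e (t j)))"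
    have blk_sum: "(\<Sum>j\<in>I. block (t(i := x)) j) = fst (e x) + c" for x
    proof -
      have "(\<Sum>j\<in>I - {i}. block (t(i := x)) j) = c"
        unfolding c_def by (intro sum.cong) (auto simp: block_def)
      then show ?thesis using i unfolding split by (simp add: block_def)
    qed
    obtain u where u: "u < n" "n dvd u + c" using ex_less_dvd_add[OF n] by blast
    \<comment> \<open>All cells of the line that lie in a block of the pattern lie in this same
      block, so one family of permutations \<open>P a\<close> governs the line.\<close>
    define a where "a = (block t)(i := u)"
    have a: "block (t(i := x)) = a" if "fst (e x) = u" for x
      using that i by (auto simp: a_def block_def fun_eq_iff)
    have blk_iff: "block (t(i := x)) \<in> blocks \<longleftrightarrow> fst (e x) = u" if "x \<in> {1..N}" for x
    proof -
      have "block (t(i := x)) \<in> I \<rightarrow>\<^sub>E {..<n}"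
        using e_in that t_in by (auto simp: block_def)
      then have "block (t(i := x)) \<in> blocks \<longleftrightarrow> n dvd fst (e x) + c"
        by (simp add: blocks_def blk_sum)
      also have "\<dots> \<longleftrightarrow> fst (e x) = u"
        using u dvd_add_less_unique[of n "fst (e x)" c u] e_in[OF that] by auto
      finally show ?thesis .
    qed
    define w where "w = (\<Sum>j\<in>I - {i}. P a j (snd (e (t j))))"
    have sum: "(\<Sum>j\<in>I. P a j (snd (e ((t(i := x)) j)))) = P a i (snd (e x)) + w" for x
    proof -
      have "(\<Sum>j\<in>I - {i}. P a j (snd (e ((t(i := x)) j)))) = w"
        unfolding w_def by (intro sum.cong) auto
      then show ?thesis unfolding split by simp
    qed
    have one_iff: "cube P (t(i := x)) = 1 \<longleftrightarrow> fst (e x) = u \<and> s dvd P a i (snd (e x)) + w"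
      if "x \<in> {1..N}" for x
      using upd[OF that] blk_iff[OF that] a[of x] sum[of x] by (auto simp: cube_def)
    \<comment> \<open>Any cell of the line with residue \<open>u\<close> certifies that
      \<open>a\<close> belongs to the pattern; position \<open>0\<close> exists since
      \<open>s > 0\<close>.\<close>
    obtain x0 where x0: "x0 \<in> {1..N}" "e x0 = (u, 0)" using ex_e u s_pos by blast
    have "a \<in> blocks" using blk_iff[OF x0(1)] a[of x0] x0 by simp
    then have Pai: "P a i permutes {..<s}" using P i by blast
    obtain y where y: "y < s" "s dvd y + w" using ex_less_dvd_add[OF s_pos] by blast
    obtain z where z: "z < s" "P a i z = y"
      using permutes_image[OF Pai] y(1) by (metis imageE lessThan_iff)
    obtain x where x: "x \<in> {1..N}" "e x = (u, z)" using ex_e u z by blast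
    show ?thesis
    proof (rule ex1I[of _ "t(i := x)"])
      show "t(i := x) \<in> L \<and> cube P (t(i := x)) = 1"
        using x one_iff[OF x(1)] y z L by auto
      fix t' assume t': "t' \<in> L \<and> cube P t' = 1"
      then obtain x' where x': "x' \<in> {1..N}" "t' = t(i := x')" using L by blast
      with t' one_iff[OF x'(1)] have eq: "fst (e x') = u" "s dvd P a i (snd (e x')) + w" by auto
      have "P a i (snd (e x')) < s"
        using permutes_in_image[OF Pai] e_in[OF x'(1)] by auto
      then have "P a i (snd (e x')) = P a i z"
        using dvd_add_less_unique[OF eq(2) y(2)] y(1) z(2) by simp
      then have "snd (e x') = z" using permutes_inj[OF Pai] by (auto dest: injD)
      then have "e x' = e x" using eq(1) x(2) by (simp add: prod_eq_iff)
      then show "t' = t(i := x)" using e_inj x(1) x' by blast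
    qed
  qed
  moreover have "cube P \<in> cells d N \<rightarrow>\<^sub>E {0, 1}" by (auto simp: cube_def)
  ultimately show ?thesis by (simp add: latin_hypercubes_def)
qed

section \<open>Diagonals with k cells in every block\<close>

text \<open>
  A diagonal is parametrised by choosing, for every coordinate \<open>i\<close> and residue \<open>v\<close>, a bijection between
  \<open>[s]\<close> and the points of \<open>X\<close> whose block has \<open>i\<close>-th entry \<open>v\<close>: a fixed one, \<open>\<beta> i v\<close>, followed by the
  permutation \<open>\<theta> (i, v)\<close>. Permuting the \<open>k\<close> points of a block gives the same diagonal.
\<close>

definition X :: "((nat \<Rightarrow> nat) \<times> nat) set" where "X = blocks \<times> {..<k}"

lemma finite_X [simp]: "finite X" and card_X: "card X = N"
  using card_blocks_k by (simp_all add: X_def card_cartesian_product)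

definition \<beta> :: "nat \<Rightarrow> nat \<Rightarrow> (nat \<Rightarrow> nat) \<times> nat \<Rightarrow> nat" where
  "\<beta> i v = (SOME f. bij_betw f {x \<in> X. fst x i = v} {..<s})"

text \<open>There are n^(d-1) blocks with \<open>i\<close>-th entry \<open>v\<close>, each carrying
  \<open>k\<close> points, which makes exactly \<open>s\<close> points. This justifies the choice in
  \<open>\<beta>\<close> and explains the locale equation for \<open>s\<close>.\<close>

lemma bij_\<beta>:
  assumes "i \<in> I" "v < n"
  shows "bij_betw (\<beta> i v) {x \<in> X. fst x i = v} {..<s}"
proof -
  have "{x \<in> X. fst x i = v} = {a \<in> blocks. a i = v} \<times> {..<k}"
    by (auto simp: X_def)
  moreover have "card {a \<in> blocks. a i = v} = n ^ (d - 1)"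
    using card_PiE_dvd_sum_fibre[OF n finite_I assms(1) _ assms(2)] d
    by (simp add: blocks_def card_I conj_assoc)
  ultimately have "card {x \<in> X. fst x i = v} = card {..<s}"
    by (simp add: card_cartesian_product s)
  then have "\<exists>f. bij_betw f {x \<in> X. fst x i = v} {..<s}"
    by (intro finite_same_card_bij) auto
  then show ?thesis unfolding \<beta>_def by (rule someI_ex)
qed

definition \<Theta> :: "(nat \<times> nat \<Rightarrow> nat \<Rightarrow> nat) set" where
  "\<Theta> = (I \<times> {..<n} \<rightarrow>\<^sub>E {p. p permutes {..<s}})"

definition pos :: "(nat \<times> nat \<Rightarrow> nat \<Rightarrow> nat) \<Rightarrow> (nat \<Rightarrow> nat) \<times> nat \<Rightarrow> nat \<Rightarrow> nat" where
  "pos \<theta> x i = \<theta> (i, fst x i) (\<beta> i (fst x i) x)"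

definition cell :: "(nat \<times> nat \<Rightarrow> nat \<Rightarrow> nat) \<Rightarrow> (nat \<Rightarrow> nat) \<times> nat \<Rightarrow> nat \<Rightarrow> nat" where
  "cell \<theta> x = (\<lambda>i\<in>I. inv_into {1..N} e (fst x i, pos \<theta> x i))"

lemma finite_\<Theta> [simp]: "finite \<Theta>" and card_\<Theta>: "card \<Theta> = fact s ^ ((d + 1) * n)"
proof -
  show "finite \<Theta>"
    unfolding \<Theta>_def by (intro finite_PiE) (auto simp: finite_permutations)
  show "card \<Theta> = fact s ^ ((d + 1) * n)"
    unfolding \<Theta>_def
    by (simp add: card_funcsetE card_permutations[OF card_lessThan] card_cartesian_product card_I)
qed

lemma fst_X: "x \<in> X \<Longrightarrow> i \<in> I \<Longrightarrow> fst x i < n"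
  by (auto simp: X_def blocks_def PiE_iff)

lemma \<theta>_permutes: "\<theta> \<in> \<Theta> \<Longrightarrow> i \<in> I \<Longrightarrow> v < n \<Longrightarrow> \<theta> (i, v) permutes {..<s}"
  by (auto simp: \<Theta>_def PiE_iff)

context
  fixes \<theta> assumes \<theta>: "\<theta> \<in> \<Theta>"
begin

lemma pos_less:
  assumes "x \<in> X" "i \<in> I"
  shows "pos \<theta> x i < s"
proof -
  have "\<beta> i (fst x i) x \<in> {..<s}"
    by (rule bij_betw_apply[OF bij_\<beta>[OF assms(2) fst_X[OF assms]]]) (simp add: assms)
  then show ?thesis
    using permutes_in_image[OF \<theta>_permutes[OF \<theta> assms(2) fst_X[OF assms]]]
    by (simp add: pos_def)
qed

lemma pos_inj:
  assumes "x \<in> X" "y \<in> X" "i \<in> I" "fst x i = fst y i" "pos \<theta> x i = pos \<theta> y i"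
  shows "x = y"
proof -
  have "\<beta> i (fst x i) x = \<beta> i (fst x i) y"
    using permutes_inj[OF \<theta>_permutes[OF \<theta>, of i "fst x i"]] fst_X[of x i] assms
    by (auto simp: pos_def dest: injD)
  then show ?thesis
    using bij_betw_imp_inj_on[OF bij_\<beta>[of i "fst x i"]] fst_X[of x i] assms by (auto dest: inj_onD)
qed

lemma cell_in: "x \<in> X \<Longrightarrow> i \<in> I \<Longrightarrow> cell \<theta> x i \<in> {1..N}"
  and e_cell: "x \<in> X \<Longrightarrow> i \<in> I \<Longrightarrow> e (cell \<theta> x i) = (fst x i, pos \<theta> x i)"
proof -
  assume x: "x \<in> X" "i \<in> I"
  then have *: "(fst x i, pos \<theta> x i) \<in> e ` {1..N}"
    using bij_betw_imp_surj_on[OF e] fst_X pos_less by auto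
  show "cell \<theta> x i \<in> {1..N}" using inv_into_into[OF *] x by (simp add: cell_def)
  show "e (cell \<theta> x i) = (fst x i, pos \<theta> x i)" using f_inv_into_f[OF *] x by (simp add: cell_def)
qed

lemma cell_cells: "x \<in> X \<Longrightarrow> cell \<theta> x \<in> cells d N"
  using cell_in by (auto simp: cells_def I_def cell_def)

lemma block_cell: "x \<in> X \<Longrightarrow> block (cell \<theta> x) = fst x"
  using e_cell by (auto simp: block_def fun_eq_iff X_def blocks_def PiE_iff extensional_def)

text \<open>Residue and position in one coordinate already identify the point, by
  \<open>pos_inj\<close>; surjectivity follows from \<open>card X = N\<close>. This is why the image
  of \<open>cell \<theta>\<close> meets each hyperplane exactly once.\<close>

lemma bij_cell:
  assumes "i \<in> I"
  shows "bij_betw (\<lambda>x. cell \<theta> x i) X {1..N}"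
proof -
  have inj: "inj_on (\<lambda>x. cell \<theta> x i) X"
  proof (rule inj_onI)
    fix x y assume xy: "x \<in> X" "y \<in> X" "cell \<theta> x i = cell \<theta> y i"
    then show "x = y"
      using pos_inj[OF xy(1,2) assms] e_cell[OF xy(1) assms] e_cell[OF xy(2) assms] by simp
  qed
  moreover have "(\<lambda>x. cell \<theta> x i) ` X = {1..N}"
    using inj cell_in assms by (intro card_subset_eq) (auto simp: card_image card_X)
  ultimately show ?thesis by (simp add: bij_betw_def)
qed

lemma inj_cell: "inj_on (cell \<theta>) X"
proof (rule inj_onI)
  fix x y assume xy: "cell \<theta> x = cell \<theta> y" "x \<in> X" "y \<in> X"
  have "1 \<in> I" by (simp add: I_def)
  from inj_onD[OF bij_betw_imp_inj_on[OF bij_cell[OF this]] _ xy(2,3)] show "x = y"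
    by (simp add: xy(1))
qed

lemma cell_image_transversal:
  assumes "\<And>x. x \<in> X \<Longrightarrow> A (cell \<theta> x) = 1"
  shows "cell \<theta> ` X \<in> transversals d N A"
proof -
  have "\<exists>!t. t \<in> cell \<theta> ` X \<and> t \<in> H" if "H \<in> hyperplanes d N" for H
  proof -
    obtain i v where H: "H = {t \<in> cells d N. t i = v}" and i: "i \<in> I" and v: "v \<in> {1..N}"
      using \<open>H \<in> hyperplanes d N\<close> by (auto simp: hyperplanes_def I_def)
    obtain x where x: "x \<in> X" "cell \<theta> x i = v"
      using bij_betw_imp_surj_on[OF bij_cell[OF i]] v by (metis (no_types, lifting) imageE)
    show ?thesis
    proof (rule ex1I[of _ "cell \<theta> x"])
      show "cell \<theta> x \<in> cell \<theta> ` X \<and> cell \<theta> x \<in> H"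
        using x cell_cells by (auto simp: H)
      fix t assume "t \<in> cell \<theta> ` X \<and> t \<in> H"
      then show "t = cell \<theta> x"
        using x bij_betw_imp_inj_on[OF bij_cell[OF i]] by (auto simp: H dest: inj_onD)
    qed
  qed
  then show ?thesis
    using assms cell_cells
    by (auto simp: transversals_def one_elements_def card_image[OF inj_cell] card_X)
qed

end

text \<open>The cells reveal all positions. Every \<open>y < s\<close> is a value of
  \<open>\<beta> i v\<close>, so these positions determine \<open>\<theta> (i, v)\<close> on
  \<open>{..<s}\<close>; elsewhere a permutation of \<open>{..<s}\<close> is the identity.\<close>

lemma inj_on_cell:
  assumes "\<theta> \<in> \<Theta>" "\<theta>' \<in> \<Theta>" and eq: "\<And>x. x \<in> X \<Longrightarrow> cell \<theta> x = cell \<theta>' x"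
  shows "\<theta> = \<theta>'"
proof (rule PiE_ext)
  show "\<theta> \<in> I \<times> {..<n} \<rightarrow>\<^sub>E {p. p permutes {..<s}}" "\<theta>' \<in> I \<times> {..<n} \<rightarrow>\<^sub>E {p. p permutes {..<s}}"
    using assms(1,2) by (simp_all add: \<Theta>_def)
  fix z assume "z \<in> I \<times> {..<n}"
  then obtain i v where z: "z = (i, v)" "i \<in> I" "v < n" by auto
  have "\<theta> (i, v) y = \<theta>' (i, v) y" for y
  proof (cases "y < s")
    case True
    then have "y \<in> \<beta> i v ` {x \<in> X. fst x i = v}"
      by (simp add: bij_betw_imp_surj_on[OF bij_\<beta>[OF z(2,3)]])
    then obtain x where x: "x \<in> X" "fst x i = v" "\<beta> i v x = y" by blast
    have "pos \<theta> x i = pos \<theta>' x i"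
      using e_cell[OF assms(1) x(1) z(2)] e_cell[OF assms(2) x(1) z(2)] eq[OF x(1)] by simp
    then show ?thesis by (simp add: pos_def x)
  next
    case False
    then show ?thesis
      using permutes_not_in[OF \<theta>_permutes[OF assms(1) z(2,3)], of y]
        permutes_not_in[OF \<theta>_permutes[OF assms(2) z(2,3)], of y] by simp
  qed
  then show "\<theta> z = \<theta>' z" unfolding z(1) by (rule ext)
qed

text \<open>Blocks split \<open>T\<close> into parts of \<open>k\<close> cells. Since
  \<open>\<theta>\<close> is determined by its labelled cells, it is determined by how it enumerates
  each part, which leaves at most k! choices per block.\<close>

lemma card_cell_image_fibre:
  "card {\<theta> \<in> \<Theta>. cell \<theta> ` X = T} \<le> fact k ^ card blocks"
proof (cases "\<exists>\<theta>\<in>\<Theta>. cell \<theta> ` X = T")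
  case False
  then have "{\<theta> \<in> \<Theta>. cell \<theta> ` X = T} = {}" by blast
  then show ?thesis by (metis card.empty le0)
next
  case True
  then obtain \<theta>0 where \<theta>0: "\<theta>0 \<in> \<Theta>" "T = cell \<theta>0 ` X" by blast
  define part where "part = (\<lambda>a. {t \<in> T. block t = a})"
  have part: "finite (part a)" "card (part a) = k" if "a \<in> blocks" for a
  proof -
    have "part a = cell \<theta>0 ` ({a} \<times> {..<k})"
      using block_cell[OF \<theta>0(1)] that by (auto simp: part_def \<theta>0(2) X_def)
    moreover have "inj_on (cell \<theta>0) ({a} \<times> {..<k})"
      by (rule inj_on_subset[OF inj_cell[OF \<theta>0(1)]]) (use that in \<open>auto simp: X_def\<close>)
    ultimately show "finite (part a)" "card (part a) = k"
      by (simp_all add: card_image card_cartesian_product)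
  qed
  \<comment> \<open>Curries \<open>cell \<theta>\<close> into one enumeration per block, so that the
    target becomes a product over blocks.\<close>
  define h where "h = (\<lambda>\<theta>. \<lambda>a\<in>blocks. \<lambda>j\<in>{..<k}. cell \<theta> (a, j))"
  let ?F = "\<lambda>a. {f \<in> {..<k} \<rightarrow>\<^sub>E part a. inj_on f {..<k}}"
  have "inj_on h {\<theta> \<in> \<Theta>. cell \<theta> ` X = T}"
  proof (rule inj_onI)
    fix \<theta> \<theta>'
    assume *: "\<theta> \<in> {\<theta> \<in> \<Theta>. cell \<theta> ` X = T}" "\<theta>' \<in> {\<theta> \<in> \<Theta>. cell \<theta> ` X = T}" "h \<theta> = h \<theta>'"
    have "cell \<theta> (a, j) = cell \<theta>' (a, j)" if "a \<in> blocks" "j < k" for a j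
      using fun_cong[OF fun_cong[OF *(3), of a], of j] that by (simp add: h_def)
    then show "\<theta> = \<theta>'"
      using * by (intro inj_on_cell) (auto simp: X_def)
  qed
  moreover have "h ` {\<theta> \<in> \<Theta>. cell \<theta> ` X = T} \<subseteq> (\<Pi>\<^sub>E a\<in>blocks. ?F a)"
  proof (rule image_subsetI)
    fix \<theta> assume "\<theta> \<in> {\<theta> \<in> \<Theta>. cell \<theta> ` X = T}"
    then have \<theta>: "\<theta> \<in> \<Theta>" "cell \<theta> ` X = T" by auto
    have "(\<lambda>j\<in>{..<k}. cell \<theta> (a, j)) \<in> ?F a" if a: "a \<in> blocks" for a
    proof -
      have "cell \<theta> (a, j) \<in> part a" if "j < k" for j
        using a that block_cell[OF \<theta>(1), of "(a, j)"] \<theta>(2) by (auto simp: part_def X_def)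
      moreover have "inj_on (\<lambda>j\<in>{..<k}. cell \<theta> (a, j)) {..<k}"
        using inj_cell[OF \<theta>(1)] a by (auto simp: inj_on_def X_def)
      ultimately show ?thesis by simp
    qed
    then show "h \<theta> \<in> (\<Pi>\<^sub>E a\<in>blocks. ?F a)"
      unfolding h_def by (simp only: restrict_PiE_iff) blast
  qed
  moreover have "finite (\<Pi>\<^sub>E a\<in>blocks. ?F a)"
  proof (intro finite_PiE finite_blocks)
    fix a assume "a \<in> blocks"
    then show "finite (?F a)"
      using part(1) by (intro finite_subset[of "?F a" "{..<k} \<rightarrow>\<^sub>E part a"] finite_PiE) auto
  qed
  ultimately have "card {\<theta> \<in> \<Theta>. cell \<theta> ` X = T} \<le> card (\<Pi>\<^sub>E a\<in>blocks. ?F a)"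
    by (rule card_inj_on_le)
  also have "\<dots> = (\<Prod>a\<in>blocks. card (?F a))"
    by (simp add: card_PiE)
  also have "\<dots> = (\<Prod>a\<in>blocks. fact k)"
    using part by (intro prod.cong refl card_inj_funcset) auto
  finally show ?thesis by simp
qed

section \<open>Averaging over random isotopes in the blocks\<close>

text \<open>Permuting only the first two coordinates is enough randomness for \<open>card_perm_pairs_ge\<close> to apply.\<close>

definition fams :: "((nat \<Rightarrow> nat) \<Rightarrow> (nat \<Rightarrow> nat) \<times> (nat \<Rightarrow> nat)) set" where
  "fams = (blocks \<rightarrow>\<^sub>E {\<sigma>. \<sigma> permutes {..<s}} \<times> {\<rho>. \<rho> permutes {..<s}})"

definition act :: "((nat \<Rightarrow> nat) \<Rightarrow> (nat \<Rightarrow> nat) \<times> (nat \<Rightarrow> nat)) \<Rightarrow> (nat \<Rightarrow> nat) \<Rightarrow> nat \<Rightarrow> nat \<Rightarrow> nat" where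
  "act f a i = (if i = 1 then fst (f a) else if i = 2 then snd (f a) else id)"

lemma finite_fams [simp]: "finite fams" and card_fams: "card fams = ((fact s)\<^sup>2) ^ card blocks"
proof -
  show "finite fams"
    unfolding fams_def by (intro finite_PiE) (auto simp: finite_permutations)
  show "card fams = ((fact s)\<^sup>2) ^ card blocks"
    unfolding fams_def
    by (simp add: card_funcsetE card_permutations[OF card_lessThan] card_cartesian_product power2_eq_square)
qed

lemma cube_act_latin: "f \<in> fams \<Longrightarrow> cube (act f) \<in> latin_hypercubes d N"
  by (rule cube_latin) (auto simp: act_def fams_def PiE_iff permutes_id mem_Times_iff)

text \<open>Brings the condition into the shape used by \<open>perm_pairs\<close>: coordinates other
  than 1 and 2 are not permuted and contribute the fixed term \<open>w\<close>.\<close>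

lemma cube_act_cell:
  assumes "\<theta> \<in> \<Theta>" "x \<in> X"
  shows "cube (act f) (cell \<theta> x) = 1 \<longleftrightarrow>
    s dvd fst (f (fst x)) (pos \<theta> x 1) + snd (f (fst x)) (pos \<theta> x 2) + (\<Sum>i\<in>I - {1, 2}. pos \<theta> x i)"
proof -
  have "(\<Sum>i\<in>I. act f (fst x) i (snd (e (cell \<theta> x i)))) = (\<Sum>i\<in>I. act f (fst x) i (pos \<theta> x i))"
    using e_cell[OF assms] by (intro sum.cong) auto
  also have "\<dots> = (\<Sum>i\<in>I - {1, 2}. act f (fst x) i (pos \<theta> x i)) + (\<Sum>i\<in>{1, 2}. act f (fst x) i (pos \<theta> x i))"
    using d by (intro sum.subset_diff) (auto simp: I_def)
  also have "(\<Sum>i\<in>I - {1, 2}. act f (fst x) i (pos \<theta> x i)) = (\<Sum>i\<in>I - {1, 2}. pos \<theta> x i)"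
    by (intro sum.cong) (auto simp: act_def)
  finally have "(\<Sum>i\<in>I. act f (fst x) i (snd (e (cell \<theta> x i)))) =
     fst (f (fst x)) (pos \<theta> x 1) + snd (f (fst x)) (pos \<theta> x 2) + (\<Sum>i\<in>I - {1, 2}. pos \<theta> x i)"
    by (simp add: act_def)
  moreover have "fst x \<in> blocks" using assms by (auto simp: X_def)
  ultimately show ?thesis
    using assms by (simp add: cube_def cell_cells block_cell)
qed

text \<open>A cell in block \<open>a\<close> constrains only \<open>f a\<close>, so the good
  families form a product of sets \<open>perm_pairs\<close>, one per block. Multiplying the bounds
  for the factors gives exponent \<open>N\<close>, as \<open>card blocks * k = N\<close>.\<close>

lemma card_fams_cell_ge:
  assumes "\<theta> \<in> \<Theta>"
  shows "((fact s)\<^sup>2) ^ card blocks * (s - 2 * k) ^ N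
    \<le> card {f \<in> fams. \<forall>x\<in>X. cube (act f) (cell \<theta> x) = 1} * s ^ (2 * N)"
proof -
  define G where "G = (\<lambda>a. perm_pairs s (\<lambda>j. pos \<theta> (a, j) 1) (\<lambda>j. pos \<theta> (a, j) 2)
    (\<lambda>j. \<Sum>i\<in>I - {1, 2}. pos \<theta> (a, j) i) {..<k})"
  have I12: "1 \<in> I" "2 \<in> I" using d by (auto simp: I_def)
  have G: "(fact s)\<^sup>2 * (s - 2 * k) ^ k \<le> card (G a) * s ^ (2 * k)" if "a \<in> blocks" for a
  proof -
    have "inj_on (\<lambda>j. pos \<theta> (a, j) i) {..<k}" if "i \<in> I" for i
      using pos_inj[OF assms _ _ that] \<open>a \<in> blocks\<close> by (fastforce simp: inj_on_def X_def)
    moreover have "(\<lambda>j. pos \<theta> (a, j) i) ` {..<k} \<subseteq> {..<s}" if "i \<in> I" for i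
      using pos_less[OF assms _ that] \<open>a \<in> blocks\<close> by (auto simp: X_def)
    ultimately show ?thesis
      unfolding G_def using card_perm_pairs_ge[OF s_pos, of "{..<k}" k] I12 by simp
  qed
  have "{f \<in> fams. \<forall>x\<in>X. cube (act f) (cell \<theta> x) = 1} = (\<Pi>\<^sub>E a\<in>blocks. G a)"
  proof (intro equalityI subsetI)
    fix f assume "f \<in> {f \<in> fams. \<forall>x\<in>X. cube (act f) (cell \<theta> x) = 1}"
    then have f: "f \<in> fams" "\<And>x. x \<in> X \<Longrightarrow> cube (act f) (cell \<theta> x) = 1" by auto
    have "f a \<in> G a" if "a \<in> blocks" for a
      using f that cube_act_cell[OF assms, of "(a, _)" f]
      by (auto simp: G_def perm_pairs_def fams_def PiE_iff X_def mem_Times_iff case_prod_beta)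
    then show "f \<in> (\<Pi>\<^sub>E a\<in>blocks. G a)"
      using f(1) by (auto simp: fams_def PiE_iff)
  next
    fix f assume f: "f \<in> (\<Pi>\<^sub>E a\<in>blocks. G a)"
    then have fa: "f a \<in> G a" if "a \<in> blocks" for a using that by auto
    have "f \<in> fams"
      using f by (auto simp: fams_def PiE_iff G_def perm_pairs_def mem_Times_iff case_prod_beta)
    moreover have "cube (act f) (cell \<theta> x) = 1" if "x \<in> X" for x
      unfolding cube_act_cell[OF assms that] using fa[of "fst x"] that
      by (auto simp: G_def perm_pairs_def X_def case_prod_beta)
    ultimately show "f \<in> {f \<in> fams. \<forall>x\<in>X. cube (act f) (cell \<theta> x) = 1}" by blast
  qed
  then have card: "card {f \<in> fams. \<forall>x\<in>X. cube (act f) (cell \<theta> x) = 1} = (\<Prod>a\<in>blocks. card (G a))"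
    by (simp add: card_PiE)
  have "((fact s)\<^sup>2) ^ card blocks * (s - 2 * k) ^ N = (\<Prod>a\<in>blocks. (fact s)\<^sup>2 * (s - 2 * k) ^ k)"
    by (simp add: power_mult_distrib power_mult[symmetric] card_blocks_k mult.commute[of k])
  also have "\<dots> \<le> (\<Prod>a\<in>blocks. card (G a) * s ^ (2 * k))"
    using G by (intro prod_mono) auto
  also have "\<dots> = (\<Prod>a\<in>blocks. card (G a)) * s ^ (2 * N)"
  proof -
    have "(s ^ (2 * k)) ^ card blocks = s ^ (2 * N)"
      unfolding power_mult[symmetric] by (simp only: card_blocks_k[symmetric] ac_simps)
    then show ?thesis by (simp only: prod.distrib prod_constant)
  qed
  finally show ?thesis using card by simp
qed

text \<open>Each good \<open>\<theta>\<close> yields a transversal, and each transversal arises from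
  at most (k!)^(number of blocks) parameters.\<close>

lemma card_good_le:
  assumes "f \<in> fams"
  shows "card {\<theta> \<in> \<Theta>. \<forall>x\<in>X. cube (act f) (cell \<theta> x) = 1} \<le> max_transversals d N * fact k ^ card blocks"
proof -
  let ?T = "transversals d N (cube (act f))"
  have "{\<theta> \<in> \<Theta>. \<forall>x\<in>X. cube (act f) (cell \<theta> x) = 1} \<subseteq> (\<Union>T\<in>?T. {\<theta> \<in> \<Theta>. cell \<theta> ` X = T})"
    using cell_image_transversal by auto
  then have "card {\<theta> \<in> \<Theta>. \<forall>x\<in>X. cube (act f) (cell \<theta> x) = 1}
      \<le> card (\<Union>T\<in>?T. {\<theta> \<in> \<Theta>. cell \<theta> ` X = T})"
    by (intro card_mono) (auto simp: finite_transversals)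
  also have "\<dots> \<le> (\<Sum>T\<in>?T. card {\<theta> \<in> \<Theta>. cell \<theta> ` X = T})"
    by (rule card_UN_le) (rule finite_transversals)
  also have "\<dots> \<le> (\<Sum>T\<in>?T. fact k ^ card blocks)"
    by (intro sum_mono card_cell_image_fibre)
  also have "\<dots> = card ?T * fact k ^ card blocks" by simp
  also have "card ?T \<le> max_transversals d N"
    unfolding max_transversals_def
    using cube_act_latin[OF assms] by (intro Max_ge) (auto simp: finite_latin_hypercubes)
  finally show ?thesis by simp
qed

text \<open>First moment argument: count pairs of a family \<open>f\<close> and a parameter
  \<open>\<theta>\<close> whose cells are all 1-elements, from below for fixed
  \<open>\<theta>\<close> and from above for fixed \<open>f\<close>, then cancel
  \<open>card fams\<close>.\<close>

lemma max_transversals_ge: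
  "fact s ^ ((d + 1) * n) * (s - 2 * k) ^ N \<le> max_transversals d N * fact k ^ n ^ d * s ^ (2 * N)"
proof -
  let ?R = "\<lambda>f \<theta>. \<forall>x\<in>X. cube (act f) (cell \<theta> x) = 1"
  let ?M = "max_transversals d N * fact k ^ card blocks"
  have "card fams * (fact s ^ ((d + 1) * n) * (s - 2 * k) ^ N)
      = (\<Sum>\<theta>\<in>\<Theta>. ((fact s)\<^sup>2) ^ card blocks * (s - 2 * k) ^ N)"
    by (simp add: card_\<Theta> card_fams)
  also have "\<dots> \<le> (\<Sum>\<theta>\<in>\<Theta>. card {f \<in> fams. ?R f \<theta>} * s ^ (2 * N))"
    by (intro sum_mono card_fams_cell_ge)
  also have "\<dots> = (\<Sum>f\<in>fams. card {\<theta> \<in> \<Theta>. ?R f \<theta>}) * s ^ (2 * N)"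
    using sum_card_swap[of fams \<Theta> ?R] by (simp add: sum_distrib_right[symmetric])
  also have "\<dots> \<le> (\<Sum>f\<in>fams. ?M) * s ^ (2 * N)"
    by (intro mult_right_mono sum_mono card_good_le) auto
  also have "\<dots> = card fams * (?M * s ^ (2 * N))" by simp
  finally have "fact s ^ ((d + 1) * n) * (s - 2 * k) ^ N \<le> ?M * s ^ (2 * N)"
    by (simp add: card_fams)
  then show ?thesis by (simp add: card_blocks)
qed

end

section \<open>Asymptotic evaluation\<close>

text \<open>Put k = n and s = n^d and take N-th roots. The Stirling bounds leave s^d / (n e^d) =
  N^(d-1) / e^d, up to one factor from n! and one from s - 2n.\<close>

lemma max_transversals_power_ge:
  fixes d n :: nat
  assumes "d \<ge> 3" "n \<ge> 2"
  shows "((exp 1 * real n) powr (- 1 / real n) * (1 - 2 / (real n)\<^sup>2)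
      * (real (n ^ (d + 1)) ^ (d - 1) / exp 1 ^ d)) ^ n ^ (d + 1)
    \<le> real (max_transversals d (n ^ (d + 1)))"
proof -
  define s where "s = n ^ d"
  define N where "N = n ^ (d + 1)"
  define M where "M = max_transversals d N"
  have pos: "real n > 0" "real s > 0" using assms by (auto simp: s_def)
  have N: "N = n * s" by (simp add: N_def s_def)
  have "\<exists>e. bij_betw e {1..N} ({..<n} \<times> {..<s})"
    by (intro finite_same_card_bij) (auto simp: N card_cartesian_product)
  then obtain e where e: "bij_betw e {1..N} ({..<n} \<times> {..<s})" ..
  have s: "s = n ^ (d - 1) * n" using assms by (cases d) (auto simp: s_def)
  interpret block_cube d n n s N e
    by unfold_locales (use assms N e s in auto)
  have main: "fact s ^ ((d + 1) * n) * real (s - 2 * n) ^ N \<le> real M * fact n ^ s * real s ^ (2 * N)"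
    using max_transversals_ge unfolding M_def s_def[symmetric]
    by (metis (mono_tags, lifting) of_nat_fact of_nat_le_iff of_nat_mult of_nat_power)
  have fs: "((real s / exp 1) ^ (d + 1)) ^ N \<le> fact s ^ ((d + 1) * n)"
  proof -
    have "((real s / exp 1) ^ (d + 1)) ^ N = ((real s / exp 1) ^ s) ^ ((d + 1) * n)"
      by (simp only: power_mult[symmetric] N ac_simps)
    also have "\<dots> \<le> fact s ^ ((d + 1) * n)"
      by (intro power_mono fact_ge_power_div_exp) auto
    finally show ?thesis .
  qed
  \<comment> \<open>The factor \<open>exp 1 * n\<close> in the upper bound for n!, spread evenly
    over its \<open>n\<close> factors.\<close>
  define r where "r = (exp 1 * real n) powr (1 / real n)"
  have "r > 0" using pos by (simp add: r_def)
  have fn: "fact n ^ s \<le> (r * (real n / exp 1)) ^ N"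
  proof -
    have "r ^ n = exp 1 * real n"
      using pos by (simp add: r_def powr_realpow[symmetric] powr_powr)
    then have "(r * (real n / exp 1)) ^ n = exp 1 * real n * (real n / exp 1) ^ n"
      by (simp only: power_mult_distrib)
    then have "(r * (real n / exp 1)) ^ N = (exp 1 * real n * (real n / exp 1) ^ n) ^ s"
      by (simp add: N power_mult)
    then show ?thesis
      using fact_le_power_div_exp[of n] assms by (simp add: power_mono)
  qed
  have sn: "real s * (1 - 2 / (real n)\<^sup>2) \<le> real (s - 2 * n)"
  proof -
    \<comment> \<open>Here \<open>d \<ge> 3\<close> enters: it gives 2n/s <= 2/n^2, an error that
      does not depend on \<open>d\<close>.\<close>
    have "n ^ 3 \<le> s" unfolding s_def using assms by (intro power_increasing) auto
    then have "real n ^ 3 \<le> real s" by (metis of_nat_le_iff of_nat_power)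
    then have "2 * real n \<le> 2 * real s / (real n)\<^sup>2"
      using pos by (simp add: field_simps power2_eq_square power3_eq_cube)
    moreover have "real s - 2 * real n \<le> real (s - 2 * n)" by linarith
    ultimately show ?thesis by (simp add: algebra_simps)
  qed
  have sq: "0 \<le> 1 - 2 / (real n)\<^sup>2"
  proof -
    have "2 ^ 2 \<le> (real n)\<^sup>2" using assms by (intro power_mono) auto
    then show ?thesis using pos by (simp add: field_simps)
  qed
  define L where "L = (real s / exp 1) ^ (d + 1) * (real s * (1 - 2 / (real n)\<^sup>2))"
  define R where "R = r * (real n / exp 1) * (real s)\<^sup>2"
  have R: "R > 0" using pos \<open>r > 0\<close> by (simp add: R_def)
  have "L ^ N = ((real s / exp 1) ^ (d + 1)) ^ N * (real s * (1 - 2 / (real n)\<^sup>2)) ^ N"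
    by (simp only: L_def power_mult_distrib)
  also have "\<dots> \<le> fact s ^ ((d + 1) * n) * real (s - 2 * n) ^ N"
    using fs sn sq pos by (intro mult_mono power_mono) auto
  also have "\<dots> \<le> real M * fact n ^ s * real s ^ (2 * N)"
    by (rule main)
  also have "\<dots> \<le> real M * (r * (real n / exp 1)) ^ N * real s ^ (2 * N)"
    by (intro mult_right_mono mult_left_mono fn) auto
  also have "\<dots> = real M * R ^ N"
    by (simp only: R_def power_mult_distrib power_mult mult.assoc)
  finally have "(L / R) ^ N \<le> real M"
    using R by (simp add: power_divide pos_divide_le_eq)
  moreover have "L / R = (exp 1 * real n) powr (- 1 / real n) * (1 - 2 / (real n)\<^sup>2)
      * (real N ^ (d - 1) / exp 1 ^ d)"
  proof -
    have "real N ^ (d - 1) = real s ^ d / real n"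
    proof -
      \<comment> \<open>Comparing exponents of \<open>n\<close>: N^(d-1) * n and s^d are both
        n^(d^2).\<close>
      have "(d + 1) * (d - 1) + 1 = d * d" using assms by (cases d) (auto simp: algebra_simps)
      then have "real N ^ (d - 1) * real n = real s ^ d"
        by (simp add: N_def s_def power_mult[symmetric] power_Suc2[symmetric] del: power_Suc)
      then show ?thesis using pos by (simp add: field_simps)
    qed
    moreover have "(exp 1 * real n) powr (- 1 / real n) = 1 / r"
      by (simp add: r_def powr_minus_divide)
    moreover have "(S / E) ^ (d + 1) * (S * q) / (r * (m / E) * S\<^sup>2) = 1 / r * q * (S ^ d / m / E ^ d)"
      if "S > 0" "E > 0" "m > 0" for S E q m :: real
      using that \<open>r > 0\<close> by (simp add: power_divide field_simps power2_eq_square)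
    ultimately show ?thesis
      using pos by (simp only: L_def R_def exp_gt_zero)
  qed
  ultimately show ?thesis by (simp add: M_def N_def)
qed

theorem theorem4p1:
  fixes d :: nat
  assumes "d \<ge> 3"
  shows "\<exists>(Ns :: nat set) (\<epsilon> :: nat \<Rightarrow> real).
           infinite Ns \<and> (\<forall>N\<in>Ns. N > 0) \<and>
           (\<epsilon> \<longlongrightarrow> 0) (inf sequentially (principal Ns)) \<and>
           (\<forall>N\<in>Ns. real (max_transversals d N)
                      \<ge> ((1 - \<epsilon> N) * (real N ^ (d - 1) / exp 1 ^ d)) ^ N)"
proof (intro exI conjI ballI)
  let ?Ns = "(\<lambda>n :: nat. n ^ (d + 1)) ` {2..}"
  define \<delta> :: "real \<Rightarrow> real" where
    "\<delta> = (\<lambda>x. 1 - (exp 1 * x) powr (- 1 / x) * (1 - 2 / x\<^sup>2))"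
  \<comment> \<open>For N = n^(d+1) the root recovers \<open>n\<close>, and
    \<open>\<delta> n\<close> is one minus the correction factor of
    \<open>max_transversals_power_ge\<close>. As \<open>\<epsilon>\<close> is defined for every
    \<open>N\<close>, its limit can be computed along all naturals and then restricted.\<close>
  define \<epsilon> where "\<epsilon> = (\<lambda>N. \<delta> (real N powr (1 / real (d + 1))))"
  have "inj_on (\<lambda>n :: nat. n ^ (d + 1)) {2..}"
    by (rule inj_onI) (simp add: power_eq_iff_eq_base del: power_Suc)
  then show "infinite ?Ns"
    using infinite_Ici by (auto dest: finite_imageD simp del: power_Suc)
  show "N > 0" if "N \<in> ?Ns" for N using that by auto
  have "(\<delta> \<longlongrightarrow> 0) at_top" unfolding \<delta>_def by real_asymp
  moreover have "filterlim (\<lambda>N. real N powr (1 / real (d + 1))) at_top sequentially"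
  proof -
    have "1 / real (d + 1) > 0" by simp
    then show ?thesis by real_asymp
  qed
  ultimately have "(\<epsilon> \<longlongrightarrow> 0) sequentially"
    unfolding \<epsilon>_def by (rule filterlim_compose)
  then show "(\<epsilon> \<longlongrightarrow> 0) (inf sequentially (principal ?Ns))"
    by (rule filterlim_mono) auto
  fix N assume "N \<in> ?Ns"
  then obtain n where n: "n \<ge> 2" "N = n ^ (d + 1)" by auto
  have "real N = real n powr real (d + 1)"
    using n by (subst powr_realpow) auto
  then have "real N powr (1 / real (d + 1)) = real n"
    using n(1) by (simp add: powr_powr)
  then show "real (max_transversals d N) \<ge> ((1 - \<epsilon> N) * (real N ^ (d - 1) / exp 1 ^ d)) ^ N"
    using max_transversals_power_ge[OF assms n(1)] by (simp add: \<epsilon>_def \<delta>_def n(2))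
qed

end
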